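(* Let $M$ be a monoid generated by a set $S$ and let $\mathbf{w}\in S^{\ast}$ be a word of length $\ell(\mathbf{w})$. For a linear extension $e:P(\mathbf{w})\to[\ell(\mathbf{w})]$ of the word poset $P(\mathbf{w})$, let $\mathbf{w}(e)$ be the word of length $\ell(\mathbf{w})$ given by $\mathbf{w}(e)_i=\mathbf{w}_{e^{-1}(i)}$ for $1\le i\le \ell(\mathbf{w})$. Then $e\mapsto \mathbf{w}(e)$ is a bijection from the set of linear extensions of $P(\mathbf{w})$ onto the set of words in the same commutation class as $\mathbf{w}$.
   Context: $S^{\ast}$ is the free monoid of finite words in $S$; $\mathbf{w}_i$ is the $i$-th letter of $\mathbf{w}$ and $\ell(\mathbf{w})$ its length; $[n]=\{1,\dots,n\}$. A monoid $M$ generated by $S$ is a quotient of $S^{\ast}$ by some relations. A relation of the form $ab=ba$ with $a,b\in S$ is called a commutation relation, and then $a$ and $b$ are said to commute. Two words are in the same commutation class if one can be obtained from the other by a finite sequence of commutation relations, i.e. by repeatedly swapping adjacent commuting letters. For a word $\mathbf{w}$, define a relation $\to$ on $[\ell(\mathbf{w})]$ by $i\to j$ iff $i\le j$ and the letters $\mathbf{w}_i,\mathbf{w}_j$ either are equal or do not commute. Let $\leq_{\mathbf{w}}$ be the transitive closure of $\to$; it is a partial order. $P(\mathbf{w})$ denotes the poset $([\ell(\mathbf{w})],\leq_{\mathbf{w}})$ together with the labelling $i\mapsto\mathbf{w}_i$. A linear extension of a finite poset $P$ with $n$ elements is an order-preserving bijection $P\to[n]$, where $[n]$ has its usual order. 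*)

theory Defs
  imports "HOL-Algebra.Group" "HOL-Library.FuncSet"
begin

inductive_set pres_cong :: "'a set \<Rightarrow> ('a list \<times> 'a list) set \<Rightarrow> ('a list \<times> 'a list) set"
  for S :: "'a set" and R :: "('a list \<times> 'a list) set" where
  base: "(u, v) \<in> R \<Longrightarrow> (u, v) \<in> pres_cong S R"
| refl: "u \<in> lists S \<Longrightarrow> (u, u) \<in> pres_cong S R"
| sym: "(u, v) \<in> pres_cong S R \<Longrightarrow> (v, u) \<in> pres_cong S R"
| trans: "(u, v) \<in> pres_cong S R \<Longrightarrow> (v, w) \<in> pres_cong S R \<Longrightarrow> (u, w) \<in> pres_cong S R"
| append: "(u, v) \<in> pres_cong S R \<Longrightarrow> (u', v') \<in> pres_cong S R
    \<Longrightarrow> (u @ u', v @ v') \<in> pres_cong S R"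

definition word_class :: "'a set \<Rightarrow> ('a list \<times> 'a list) set \<Rightarrow> 'a list \<Rightarrow> 'a list set" where
  "word_class S R u = pres_cong S R `` {u}"

definition presented_monoid :: "'a set \<Rightarrow> ('a list \<times> 'a list) set \<Rightarrow> 'a list set monoid" where
  "presented_monoid S R =
    \<lparr>carrier = lists S // pres_cong S R,
     monoid.mult = (\<lambda>A B. \<Union>u\<in>A. \<Union>v\<in>B. word_class S R (u @ v)),
     one = word_class S R []\<rparr>"

text \<open>Two letters commute if the relation \<open>ab = ba\<close> holds in the monoid; it need not be one of
  the relations listed in \<open>R\<close>. In particular every letter commutes with itself.\<close>

definition letters_commute :: "'a set \<Rightarrow> ('a list \<times> 'a list) set \<Rightarrow> 'a \<Rightarrow> 'a \<Rightarrow> bool" where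
  "letters_commute S R a b \<longleftrightarrow>
    word_class S R [a] \<otimes>\<^bsub>presented_monoid S R\<^esub> word_class S R [b] =
    word_class S R [b] \<otimes>\<^bsub>presented_monoid S R\<^esub> word_class S R [a]"

definition commutation_step :: "'a set \<Rightarrow> ('a list \<times> 'a list) set \<Rightarrow> ('a list \<times> 'a list) set" where
  "commutation_step S R =
    {(u @ [a, b] @ v, u @ [b, a] @ v) | u a b v.
      u \<in> lists S \<and> v \<in> lists S \<and> a \<in> S \<and> b \<in> S \<and> letters_commute S R a b}"

definition commutation_class :: "'a set \<Rightarrow> ('a list \<times> 'a list) set \<Rightarrow> 'a list \<Rightarrow> 'a list set" where
  "commutation_class S R w = (commutation_step S R)\<^sup>* `` {w}"

text \<open>Positions in a word are numbered from 1.\<close>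

definition letter :: "'a list \<Rightarrow> nat \<Rightarrow> 'a" where
  "letter w i = w ! (i - 1)"

definition word_arrow :: "'a set \<Rightarrow> ('a list \<times> 'a list) set \<Rightarrow> 'a list \<Rightarrow> (nat \<times> nat) set" where
  "word_arrow S R w =
    {(i, j). i \<in> {1..length w} \<and> j \<in> {1..length w} \<and> i \<le> j \<and>
      (letter w i = letter w j \<or> \<not> letters_commute S R (letter w i) (letter w j))}"

definition word_order :: "'a set \<Rightarrow> ('a list \<times> 'a list) set \<Rightarrow> 'a list \<Rightarrow> (nat \<times> nat) set" where
  "word_order S R w = (word_arrow S R w)\<^sup>+"

text \<open>Linear extensions of the finite poset \<open>(A, r)\<close>. They are taken to be extensional, so that
  two of them are equal as soon as they agree on \<open>A\<close>.\<close>

definition linear_extensions :: "'b set \<Rightarrow> ('b \<times> 'b) set \<Rightarrow> ('b \<Rightarrow> nat) set" where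
  "linear_extensions A r =
    {e \<in> A \<rightarrow>\<^sub>E {1..card A}. bij_betw e A {1..card A} \<and> (\<forall>(x, y)\<in>r. e x \<le> e y)}"

definition extension_word :: "'a list \<Rightarrow> (nat \<Rightarrow> nat) \<Rightarrow> 'a list" where
  "extension_word w e =
    map (\<lambda>i. letter w (inv_into {1..length w} e i)) [1..<Suc (length w)]"

lemma pres_cong_lists:
  assumes "R \<subseteq> lists S \<times> lists S" and "(u, v) \<in> pres_cong S R"
  shows "u \<in> lists S \<and> v \<in> lists S"
  using assms(2) by induction (use assms(1) in auto)

lemma equiv_pres_cong:
  assumes "R \<subseteq> lists S \<times> lists S"
  shows "equiv (lists S) (pres_cong S R)"
proof (rule equivI)
  show "pres_cong S R \<subseteq> lists S \<times> lists S"
    using pres_cong_lists[OF assms] by auto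
  show "refl_on (lists S) (pres_cong S R)"
    by (rule refl_onI) (rule pres_cong.refl)
  show "sym (pres_cong S R)" by (rule symI) (rule pres_cong.sym)
  show "trans (pres_cong S R)" by (rule transI) (rule pres_cong.trans)
qed

lemma word_class_mult:
  assumes "R \<subseteq> lists S \<times> lists S" and "u \<in> lists S" and "v \<in> lists S"
  shows "word_class S R u \<otimes>\<^bsub>presented_monoid S R\<^esub> word_class S R v = word_class S R (u @ v)"
proof -
  have eq: "word_class S R (u' @ v') = word_class S R (u @ v)"
    if "u' \<in> word_class S R u" "v' \<in> word_class S R v" for u' v'
  proof -
    have "(u @ v, u' @ v') \<in> pres_cong S R"
      using that by (intro pres_cong.append) (simp_all add: word_class_def)
    from equiv_class_eq[OF equiv_pres_cong[OF assms(1)] this] show ?thesis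
      by (simp add: word_class_def)
  qed
  have "u \<in> word_class S R u" "v \<in> word_class S R v"
    using assms by (simp_all add: word_class_def pres_cong.refl)
  then have "(\<Union>u'\<in>word_class S R u. \<Union>v'\<in>word_class S R v. word_class S R (u' @ v')) =
      word_class S R (u @ v)"
    using eq by blast
  then show ?thesis by (simp add: presented_monoid_def)
qed

lemma monoid_presented_monoid:
  assumes R: "R \<subseteq> lists S \<times> lists S"
  shows "monoid (presented_monoid S R)"
proof -
  have carr: "x \<in> carrier (presented_monoid S R) \<longleftrightarrow> (\<exists>u\<in>lists S. x = word_class S R u)" for x
    by (auto simp: presented_monoid_def quotient_def word_class_def)
  have one: "\<one>\<^bsub>presented_monoid S R\<^esub> = word_class S R []"
    by (simp add: presented_monoid_def)
  show ?thesis
  proof (rule monoidI)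
    fix x y assume "x \<in> carrier (presented_monoid S R)" "y \<in> carrier (presented_monoid S R)"
    then obtain u v where "u \<in> lists S" "v \<in> lists S" "x = word_class S R u" "y = word_class S R v"
      by (auto simp: carr)
    then show "x \<otimes>\<^bsub>presented_monoid S R\<^esub> y \<in> carrier (presented_monoid S R)"
      unfolding carr by (intro bexI[of _ "u @ v"]) (simp_all add: word_class_mult[OF R])
  next
    show "\<one>\<^bsub>presented_monoid S R\<^esub> \<in> carrier (presented_monoid S R)"
      unfolding carr one by (intro bexI[of _ "[]"]) auto
  next
    fix x y z
    assume "x \<in> carrier (presented_monoid S R)" "y \<in> carrier (presented_monoid S R)"
      "z \<in> carrier (presented_monoid S R)"
    then obtain u v w where "u \<in> lists S" "v \<in> lists S" "w \<in> lists S"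
      "x = word_class S R u" "y = word_class S R v" "z = word_class S R w"
      unfolding carr by blast
    then show "x \<otimes>\<^bsub>presented_monoid S R\<^esub> y \<otimes>\<^bsub>presented_monoid S R\<^esub> z =
        x \<otimes>\<^bsub>presented_monoid S R\<^esub> (y \<otimes>\<^bsub>presented_monoid S R\<^esub> z)"
      using R by (simp add: word_class_mult)
  next
    fix x assume "x \<in> carrier (presented_monoid S R)"
    then obtain u where u: "u \<in> lists S" "x = word_class S R u" by (auto simp: carr)
    show "\<one>\<^bsub>presented_monoid S R\<^esub> \<otimes>\<^bsub>presented_monoid S R\<^esub> x = x"
      using u word_class_mult[OF R, of "[]" u] by (simp add: one)
    show "x \<otimes>\<^bsub>presented_monoid S R\<^esub> \<one>\<^bsub>presented_monoid S R\<^esub> = x"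
      using u word_class_mult[OF R, of u "[]"] by (simp add: one)
  qed
qed

lemma word_order_le:
  assumes "(i, j) \<in> word_order S R w"
  shows "i \<le> j \<and> i \<in> {1..length w} \<and> j \<in> {1..length w}"
  using assms unfolding word_order_def by induction (auto simp: word_arrow_def)

lemma partial_order_on_word_order:
  "partial_order_on {1..length w} (word_order S R w)"
proof -
  have "word_order S R w \<subseteq> {1..length w} \<times> {1..length w}"
    by (auto dest: word_order_le)
  moreover have "refl_on {1..length w} (word_order S R w)"
    unfolding word_order_def by (rule refl_onI) (auto simp: word_arrow_def)
  moreover have "antisym (word_order S R w)"
    by (rule antisymI) (meson word_order_le le_antisym)
  moreover have "trans (word_order S R w)"
    unfolding word_order_def by (rule trans_trancl)
  ultimately show ?thesis
    by (simp add: partial_order_on_def preorder_on_def)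
qed

end

theory Submission
  imports Defs "HOL-Combinatorics.Transposition"
begin

text \<open>Exchanging the values \<open>k\<close> and \<open>k + 1\<close> of a linear extension gives another linear extension
  unless the two elements involved are related. In the order \<open>word_order S R w\<close>, unrelated elements
  at consecutive values carry distinct commuting letters, so these exchanges are exactly the
  commutation steps that alter the word. If two linear extensions of a finite order differ, then one
  of them has two elements at consecutive values that the other puts in the opposite order, and
  exchanging these removes one inversion without creating another. So all linear extensions are
  connected by exchanges, and their words form the commutation class of \<open>w\<close>, the word of the
  identity. Finally, a linear extension is increasing on the occurrences of each letter, and a
  strictly increasing map on a finite chain is determined by its image, so the word determines the
  extension.\<close>

lemma strict_mono_on_image_eq_imp_eq:
  fixes f g :: "'a::linorder \<Rightarrow> 'b::linorder"
  assumes "finite A" and f: "strict_mono_on A f" and g: "strict_mono_on A g"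
    and "f ` A = g ` A" and "x \<in> A"
  shows "f x = g x"
proof -
  let ?xs = "sorted_list_of_set A"
  have sorted_map: "sorted (map h ?xs) \<and> distinct (map h ?xs)" if "strict_mono_on A h"
    for h :: "'a \<Rightarrow> 'b"
  proof
    show "sorted (map h ?xs)"
      using \<open>finite A\<close> strict_mono_on_leD[OF that]
      by (intro sorted_map_mono) (auto intro: mono_onI)
    show "distinct (map h ?xs)"
      using \<open>finite A\<close> strict_mono_on_imp_inj_on[OF that] by (simp add: distinct_map)
  qed
  have "map f ?xs = map g ?xs"
    using assms sorted_map[OF f] sorted_map[OF g] by (intro sorted_distinct_set_unique) auto
  then show ?thesis
    using \<open>finite A\<close> \<open>x \<in> A\<close> by simp
qed

subsection \<open>Inversions\<close>

definition inversions :: "'a set \<Rightarrow> ('a \<Rightarrow> 'b::ord) \<Rightarrow> ('a \<Rightarrow> 'c::ord) \<Rightarrow> ('a \<times> 'a) set" where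
  "inversions A e f = {(x, y) \<in> A \<times> A. e x < e y \<and> f y < f x}"

lemma finite_inversions: "finite A \<Longrightarrow> finite (inversions A e f)"
  by (rule finite_subset[of _ "A \<times> A"]) (auto simp: inversions_def)

lemma adjacent_inversion_exists:
  fixes f :: "'a \<Rightarrow> 'b::linorder"
  assumes e: "bij_betw e A {m..n::nat}" and "inversions A e f \<noteq> {}"
  shows "\<exists>x\<in>A. \<exists>y\<in>A. e y = Suc (e x) \<and> f y < f x"
proof (rule ccontr)
  let ?g = "inv_into A e"
  assume "\<not> ?thesis"
  then have adjacent: "f x \<le> f y" if "x \<in> A" "y \<in> A" "e y = Suc (e x)" for x y
    using that by fastforce
  have step: "f (?g k) \<le> f (?g (Suc k))" if "k \<in> {m..<n}" for k
    using that bij_betwE[OF bij_betw_inv_into[OF e]] bij_betw_inv_into_right[OF e]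
    by (intro adjacent) auto
  obtain x y where xy: "x \<in> A" "y \<in> A" "e x < e y" "f y < f x"
    using assms(2) by (auto simp: inversions_def)
  have "f (?g (e x)) \<le> f (?g (e y))"
  proof (rule lift_Suc_mono_le_ivl[where f = "\<lambda>k. f (?g k)", OF step])
    show "{e x..<e y} \<subseteq> {m..<n}"
      using bij_betwE[OF e] xy(1,2) by fastforce
  qed (use xy in auto)
  then show False
    using xy bij_betw_inv_into_left[OF e] by simp
qed

lemma inversions_empty_imp_eq:
  fixes e f :: "'a \<Rightarrow> 'b::linorder"
  assumes e: "bij_betw e A B" and f: "bij_betw f A B" and "finite B"
    and "inversions A e f = {}" and "x \<in> A"
  shows "e x = f x"
proof -
  let ?g = "inv_into A e"
  have g: "bij_betw ?g B A"
    using e by (rule bij_betw_inv_into)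
  have mono: "strict_mono_on B (f \<circ> ?g)"
  proof (rule strict_mono_onI)
    fix k l assume kl: "k \<in> B" "l \<in> B" "k < l"
    have in_A: "?g k \<in> A" "?g l \<in> A"
      using kl bij_betwE[OF g] by auto
    moreover have less: "e (?g k) < e (?g l)"
      using kl bij_betw_inv_into_right[OF e] by simp
    ultimately have "f (?g k) \<le> f (?g l)"
      using \<open>inversions A e f = {}\<close> by (force simp: inversions_def)
    moreover have "f (?g k) \<noteq> f (?g l)"
      using in_A less inj_onD[OF bij_betw_imp_inj_on[OF f], of "?g k" "?g l"] by auto
    ultimately show "(f \<circ> ?g) k < (f \<circ> ?g) l" by simp
  qed
  have image: "(f \<circ> ?g) ` B = id ` B"
    using bij_betw_trans[OF g f] by (simp add: bij_betw_def)
  have "(f \<circ> ?g) (e x) = id (e x)"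
    using \<open>finite B\<close> mono strict_mono_on_id image bij_betw_apply[OF e \<open>x \<in> A\<close>]
    by (rule strict_mono_on_image_eq_imp_eq)
  then show ?thesis
    using bij_betw_inv_into_left[OF e \<open>x \<in> A\<close>] by simp
qed

lemma inversions_transpose_psubset:
  fixes e :: "'a \<Rightarrow> nat" and f :: "'a \<Rightarrow> 'b::linorder"
  assumes e: "inj_on e A" and xy: "x \<in> A" "y \<in> A" "e y = Suc (e x)" "f y < f x"
  shows "inversions A (e \<circ> transpose x y) f \<subset> inversions A e f"
proof
  have no_value_between: "e z < e x \<or> e y < e z" if "z \<in> A" "z \<noteq> x" "z \<noteq> y" for z
    using that xy inj_onD[OF e, of z x] inj_onD[OF e, of z y] by linarith
  show "inversions A (e \<circ> transpose x y) f \<subseteq> inversions A e f"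
    using xy no_value_between by (fastforce simp: inversions_def transpose_def split: if_splits)
  have "(x, y) \<in> inversions A e f" "(x, y) \<notin> inversions A (e \<circ> transpose x y) f"
    using xy by (auto simp: inversions_def)
  then show "inversions A (e \<circ> transpose x y) f \<noteq> inversions A e f" by blast
qed

subsection \<open>Linear extensions\<close>

lemma linear_extensions_iff:
  "e \<in> linear_extensions A r \<longleftrightarrow>
    e \<in> extensional A \<and> bij_betw e A {1..card A} \<and> (\<forall>(x, y)\<in>r. e x \<le> e y)"
  by (auto simp: linear_extensions_def PiE_def dest: bij_betw_imp_funcset)

lemma linear_extension_bij_betw:
  "e \<in> linear_extensions {1..n} r \<Longrightarrow> bij_betw e {1..n} {1..n}"
  by (simp add: linear_extensions_iff)

lemma linear_extensions_trancl: "linear_extensions A (r\<^sup>+) = linear_extensions A r"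
proof -
  have "e x \<le> e y" if "\<forall>(x, y)\<in>r. e x \<le> e y" and "(x, y) \<in> r\<^sup>+" for e :: "'a \<Rightarrow> nat" and x y
    using that(2) by induction (use that(1) in fastforce)+
  then have "(\<forall>(x, y)\<in>r\<^sup>+. e x \<le> e y) \<longleftrightarrow> (\<forall>(x, y)\<in>r. e x \<le> e y)" for e :: "'a \<Rightarrow> nat"
    by blast
  then show ?thesis
    unfolding linear_extensions_def by simp
qed

lemma restrict_id_in_linear_extensions:
  assumes "r \<subseteq> {1..n} \<times> {1..n}" and "\<And>i j. (i, j) \<in> r \<Longrightarrow> i \<le> j"
  shows "restrict id {1..n} \<in> linear_extensions {1..n} r"
proof -
  have "\<forall>(i, j)\<in>r. restrict id {1..n} i \<le> restrict id {1..n} j"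
    using assms by fastforce
  moreover have "bij_betw (restrict id {1..n}) {1..n} {1..n}"
    by (simp add: bij_betw_restrict_eq)
  ultimately show ?thesis
    unfolding linear_extensions_iff by simp
qed

lemma transpose_in_linear_extensions:
  assumes e: "e \<in> linear_extensions A r" and r: "r \<subseteq> A \<times> A"
    and xy: "x \<in> A" "y \<in> A" "e y = Suc (e x)" "(x, y) \<notin> r"
  shows "e \<circ> transpose x y \<in> linear_extensions A r"
proof -
  note e = e[unfolded linear_extensions_iff]
  have inj: "u = v" if "u \<in> A" "v \<in> A" "e u = e v" for u v
    using e that by (auto simp: bij_betw_def dest: inj_onD)
  have "(e \<circ> transpose x y) u \<le> (e \<circ> transpose x y) v" if uv: "(u, v) \<in> r" for u v
  proof (cases "u = v")
    case False
    have in_A: "u \<in> A" "v \<in> A"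
      using uv r by auto
    have less: "e u < e v"
      using e uv False inj[OF in_A] by (fastforce simp: order.strict_iff_order)
    have "e v \<noteq> e y" if "u = x"
      using that uv xy inj[OF in_A(2) xy(2)] by blast
    moreover have "e u \<noteq> e x" if "v = y"
      using that uv xy inj[OF in_A(1) xy(1)] by blast
    ultimately show ?thesis
      using less xy(3) by (auto simp: transpose_def)
  qed simp
  moreover have "e \<circ> transpose x y \<in> extensional A"
    using e xy(1,2) by (auto simp: extensional_def transpose_def)
  ultimately show ?thesis
    using e xy(1,2) by (auto simp: linear_extensions_iff bij_betw_swap_iff)
qed

lemma linear_extensions_adjacent_induct [consumes 3, case_names base swap]:
  assumes e: "e \<in> linear_extensions A r" and f: "f \<in> linear_extensions A r"
    and r: "r \<subseteq> A \<times> A"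
    and base: "P f"
    and swap: "\<And>e x y. e \<in> linear_extensions A r \<Longrightarrow> P e \<Longrightarrow> x \<in> A \<Longrightarrow> y \<in> A \<Longrightarrow>
      e y = Suc (e x) \<Longrightarrow> (x, y) \<notin> r \<Longrightarrow> P (e \<circ> transpose x y)"
  shows "P e"
  using e
proof (induction "card (inversions A e f)" arbitrary: e rule: less_induct)
  case less
  note e = less.prems[unfolded linear_extensions_iff] and f = f[unfolded linear_extensions_iff]
  show ?case
  proof (cases "inversions A e f = {}")
    case True
    then have "e = f"
      using e f inversions_empty_imp_eq[of e A "{1..card A}" f]
      by (meson extensionalityI finite_atLeastAtMost)
    then show ?thesis using base by simp
  next
    case False
    obtain x y where xy: "x \<in> A" "y \<in> A" "e y = Suc (e x)" "f y < f x"
      using adjacent_inversion_exists[of e A 1 "card A" f] e False by blast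
    let ?e = "e \<circ> transpose x y"
    have "finite A"
      using e bij_betw_finite by blast
    have "(x, y) \<notin> r" "(y, x) \<notin> r"
      using e f xy by fastforce+
    then have e': "?e \<in> linear_extensions A r"
      using less.prems r xy by (intro transpose_in_linear_extensions)
    have "inversions A ?e f \<subset> inversions A e f"
      using e xy by (intro inversions_transpose_psubset) (auto simp: bij_betw_def)
    then have "P ?e"
      using e' less.hyps psubset_card_mono[OF finite_inversions[OF \<open>finite A\<close>]] by blast
    then have "P (?e \<circ> transpose y x)"
      using e' xy \<open>(y, x) \<notin> r\<close> by (simp add: swap)
    then show ?thesis
      by (simp add: comp_assoc transpose_commute)
  qed
qed

subsection \<open>Words of linear extensions\<close>

lemma list_eq_iff_letter_eq:
  "u = v \<longleftrightarrow> length u = length v \<and> (\<forall>k\<in>{1..length u}. letter u k = letter v k)"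
proof -
  have positions: "{1..length u} = Suc ` {..<length u}"
    by (simp add: image_Suc_lessThan)
  show ?thesis
    unfolding list_eq_iff_nth_eq positions by (auto simp: letter_def)
qed

lemma letter_transpose_adjacent:
  assumes "1 \<le> k"
  shows "letter (u @ [b, a] @ v) (transpose (Suc (length u)) (Suc (Suc (length u))) k) =
    letter (u @ [a, b] @ v) k"
  using assms by (auto simp: letter_def nth_append nth_Cons' transpose_def)

lemma split_adjacent_letters:
  assumes "1 \<le> k" and "k < length v"
  obtains u x where "v = u @ [letter v k, letter v (Suc k)] @ x" and "Suc (length u) = k"
proof
  show "v = take (k - 1) v @ [letter v k, letter v (Suc k)] @ drop (Suc k) v"
    using assms id_take_nth_drop[of "k - 1" v] Cons_nth_drop_Suc[of k v] by (simp add: letter_def)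
  show "Suc (length (take (k - 1) v)) = k"
    using assms by simp
qed

lemma length_extension_word [simp]: "length (extension_word w e) = length w"
  by (simp add: extension_word_def del: upt_Suc)

lemma letter_extension_word:
  assumes "bij_betw e {1..length w} {1..length w}" and "i \<in> {1..length w}"
  shows "letter (extension_word w e) (e i) = letter w i"
proof -
  have "letter (extension_word w e) k = letter w (inv_into {1..length w} e k)"
    if "k \<in> {1..length w}" for k
    using that by (simp add: extension_word_def letter_def less_diff_conv2 del: upt_Suc)
  then show ?thesis
    using bij_betw_apply[OF assms] bij_betw_inv_into_left[OF assms] by metis
qed

lemma extension_word_eqI:
  assumes e: "bij_betw e {1..length w} {1..length w}" and "length v = length w"
    and letters: "\<And>i. i \<in> {1..length w} \<Longrightarrow> letter v (e i) = letter w i"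
  shows "extension_word w e = v"
  unfolding list_eq_iff_letter_eq
proof (intro conjI ballI)
  fix k assume "k \<in> {1..length (extension_word w e)}"
  then obtain i where "i \<in> {1..length w}" "k = e i"
    using bij_betw_imp_surj_on[OF e] by (metis imageE length_extension_word)
  then show "letter (extension_word w e) k = letter v k"
    using letter_extension_word[OF e] letters by simp
qed (use assms(2) in simp)

lemma extension_word_restrict_id: "extension_word w (restrict id {1..length w}) = w"
  by (rule extension_word_eqI) (simp_all add: bij_betw_restrict_eq)

lemma extension_word_transpose:
  assumes e: "bij_betw e {1..length w} {1..length w}"
    and ij: "i \<in> {1..length w}" "j \<in> {1..length w}" "e j = Suc (e i)"
  obtains u x where "extension_word w e = u @ [letter w i, letter w j] @ x"
    and "extension_word w (e \<circ> transpose i j) = u @ [letter w j, letter w i] @ x"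
    and "Suc (length u) = e i"
proof -
  let ?v = "extension_word w e" and ?e = "e \<circ> transpose i j"
  have range: "e l \<in> {1..length w}" if "l \<in> {1..length w}" for l
    using e that by (rule bij_betw_apply)
  have letters: "letter ?v (e i) = letter w i" "letter ?v (Suc (e i)) = letter w j"
    using letter_extension_word[OF e ij(1)] letter_extension_word[OF e ij(2)] ij(3) by simp_all
  have "1 \<le> e i" "e i < length ?v"
    using range[OF ij(1)] range[OF ij(2)] ij(3) by auto
  then obtain u x where "?v = u @ [letter ?v (e i), letter ?v (Suc (e i))] @ x"
    and u: "Suc (length u) = e i"
    by (rule split_adjacent_letters)
  then have word: "?v = u @ [letter w i, letter w j] @ x"
    unfolding letters by blast
  have "extension_word w ?e = u @ [letter w j, letter w i] @ x" (is "_ = ?v'")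
  proof (rule extension_word_eqI)
    show "bij_betw ?e {1..length w} {1..length w}"
      using e ij by (simp add: bij_betw_swap_iff)
    show "length ?v' = length w"
      using arg_cong[OF word, of length] by simp
  next
    fix l assume l: "l \<in> {1..length w}"
    have "?e l = transpose (e i) (e j) (e l)"
      using bij_betw_imp_inj_on[OF e] l ij(1,2) by (auto simp: transpose_def dest: inj_onD)
    then have "letter ?v' (?e l) = letter ?v (e l)"
      using range[OF l] ij(3) u[symmetric] unfolding word
      by (simp only: letter_transpose_adjacent atLeastAtMost_iff)
    then show "letter ?v' (?e l) = letter w l"
      using letter_extension_word[OF e l] by simp
  qed
  with word show thesis using u by (rule that)
qed

subsection \<open>Commutation classes\<close>

lemma letters_commute_sym: "letters_commute S R a b \<longleftrightarrow> letters_commute S R b a"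
  unfolding letters_commute_def by (rule eq_commute)

lemma commutation_class_subset_lists:
  assumes "w \<in> lists S"
  shows "commutation_class S R w \<subseteq> lists S"
proof
  fix v assume "v \<in> commutation_class S R w"
  then have "(w, v) \<in> (commutation_step S R)\<^sup>*"
    by (simp add: commutation_class_def)
  then show "v \<in> lists S"
    by cases (use assms in \<open>auto simp: commutation_step_def\<close>)
qed

lemma word_arrow_subset: "word_arrow S R w \<subseteq> {1..length w} \<times> {1..length w}"
  by (auto simp: word_arrow_def)

lemma linear_extensions_word_order:
  "linear_extensions A (word_order S R w) = linear_extensions A (word_arrow S R w)"
  by (simp add: word_order_def linear_extensions_trancl)

lemma restrict_id_in_linear_extensions_word_arrow:
  "restrict id {1..length w} \<in> linear_extensions {1..length w} (word_arrow S R w)"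
  by (rule restrict_id_in_linear_extensions) (auto simp: word_arrow_def)

lemma strict_mono_on_letter_positions:
  assumes e: "e \<in> linear_extensions {1..length w} (word_arrow S R w)"
  shows "strict_mono_on {i \<in> {1..length w}. letter w i = a} e"
proof (rule strict_mono_onI)
  fix i j assume ij: "i \<in> {i \<in> {1..length w}. letter w i = a}"
    "j \<in> {i \<in> {1..length w}. letter w i = a}" "i < j"
  then have "(i, j) \<in> word_arrow S R w"
    by (auto simp: word_arrow_def)
  then have "e i \<le> e j"
    using e by (auto simp: linear_extensions_iff)
  moreover have "e i \<noteq> e j"
    using ij inj_onD[OF bij_betw_imp_inj_on[OF linear_extension_bij_betw[OF e]]]
    by blast
  ultimately show "e i < e j" by simp
qed

lemma image_letter_positions:
  assumes e: "bij_betw e {1..length w} {1..length w}"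
  shows "e ` {i \<in> {1..length w}. letter w i = a} =
    {k \<in> {1..length w}. letter (extension_word w e) k = a}"
proof -
  have "{k \<in> {1..length w}. letter (extension_word w e) k = a} =
      {k \<in> e ` {1..length w}. letter (extension_word w e) k = a}"
    using e by (simp add: bij_betw_def)
  also have "\<dots> = e ` {i \<in> {1..length w}. letter w i = a}"
    using letter_extension_word[OF e] by auto
  finally show ?thesis by simp
qed

lemma inj_on_extension_word:
  "inj_on (extension_word w) (linear_extensions {1..length w} (word_arrow S R w))"
proof (rule inj_onI)
  let ?L = "linear_extensions {1..length w} (word_arrow S R w)"
  fix e f assume e: "e \<in> ?L" and f: "f \<in> ?L" and word: "extension_word w e = extension_word w f"
  show "e = f"
  proof (rule extensionalityI)
    fix i assume i: "i \<in> {1..length w}"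
    let ?I = "{j \<in> {1..length w}. letter w j = letter w i}"
    have "e ` ?I = f ` ?I"
      unfolding image_letter_positions[OF linear_extension_bij_betw[OF e]]
        image_letter_positions[OF linear_extension_bij_betw[OF f]] word ..
    then show "e i = f i"
      using i strict_mono_on_letter_positions[OF e] strict_mono_on_letter_positions[OF f]
      by (intro strict_mono_on_image_eq_imp_eq[of ?I]) auto
  qed (use e f in \<open>simp_all add: linear_extensions_iff\<close>)
qed

lemma adjacent_values_letters_commute:
  assumes e: "e \<in> linear_extensions {1..length w} (word_arrow S R w)"
    and ij: "i \<in> {1..length w}" "j \<in> {1..length w}" "e j = Suc (e i)" "(i, j) \<notin> word_arrow S R w"
  shows "letters_commute S R (letter w i) (letter w j)"
proof -
  have "(j, i) \<notin> word_arrow S R w"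
    using e ij(3) by (auto simp: linear_extensions_iff)
  then show ?thesis
    using ij linorder_linear[of i j]
    by (auto simp: word_arrow_def letters_commute_sym[of S R "letter w j"])
qed

lemma extension_word_in_commutation_class:
  assumes "w \<in> lists S" and e: "e \<in> linear_extensions {1..length w} (word_arrow S R w)"
  shows "extension_word w e \<in> commutation_class S R w"
  using e restrict_id_in_linear_extensions_word_arrow word_arrow_subset
proof (induction rule: linear_extensions_adjacent_induct)
  case base
  show ?case
    unfolding extension_word_restrict_id by (simp add: commutation_class_def)
next
  case (swap e i j)
  obtain u x where word: "extension_word w e = u @ [letter w i, letter w j] @ x"
    and word': "extension_word w (e \<circ> transpose i j) = u @ [letter w j, letter w i] @ x"
    using swap extension_word_transpose[of e w i j] linear_extension_bij_betw by metis
  have "extension_word w e \<in> lists S"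
    using swap commutation_class_subset_lists[OF assms(1)] by blast
  then have "(extension_word w e, extension_word w (e \<circ> transpose i j)) \<in> commutation_step S R"
    using adjacent_values_letters_commute[OF swap.hyps]
    unfolding word word' commutation_step_def by auto
  with swap show ?case
    unfolding commutation_class_def by (blast intro: rtrancl_into_rtrancl)
qed

lemma commutation_step_lifts_to_linear_extension:
  assumes e: "e \<in> linear_extensions {1..length w} (word_arrow S R w)"
    and "(extension_word w e, v) \<in> commutation_step S R"
  shows "v \<in> extension_word w ` linear_extensions {1..length w} (word_arrow S R w)"
proof -
  note bij = linear_extension_bij_betw[OF e]
  obtain u a b x where word: "extension_word w e = u @ [a, b] @ x" and v: "v = u @ [b, a] @ x"
    and commute: "letters_commute S R a b"
    using assms(2) by (auto simp: commutation_step_def)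
  show ?thesis
  proof (cases "a = b")
    case True
    then show ?thesis using e word v by (metis imageI)
  next
    case False
    have "length w = length u + 2 + length x"
      using arg_cong[OF word, of length] by simp
    then have "{Suc (length u), Suc (Suc (length u))} \<subseteq> e ` {1..length w}"
      unfolding bij_betw_imp_surj_on[OF bij] by auto
    then obtain i j where ij: "i \<in> {1..length w}" "j \<in> {1..length w}"
      and consecutive: "e i = Suc (length u)" "e j = Suc (e i)"
      by auto
    obtain u' x' where word': "extension_word w e = u' @ [letter w i, letter w j] @ x'"
      and transpose: "extension_word w (e \<circ> transpose i j) = u' @ [letter w j, letter w i] @ x'"
      and u': "Suc (length u') = e i"
      using bij ij consecutive(2) by (rule extension_word_transpose)
    have parts: "u' = u" "letter w i = a" "letter w j = b" "x' = x"
      using word word' u' consecutive(1) by auto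
    have "(i, j) \<notin> word_arrow S R w"
      using False commute by (simp add: word_arrow_def parts)
    then have "e \<circ> transpose i j \<in> linear_extensions {1..length w} (word_arrow S R w)"
      using e ij consecutive(2) by (intro transpose_in_linear_extensions word_arrow_subset)
    then show ?thesis
      using transpose unfolding v parts by (metis imageI)
  qed
qed

lemma commutation_class_subset_extension_words:
  "commutation_class S R w \<subseteq>
    extension_word w ` linear_extensions {1..length w} (word_arrow S R w)"
proof
  fix v assume "v \<in> commutation_class S R w"
  then have "(w, v) \<in> (commutation_step S R)\<^sup>*"
    by (simp add: commutation_class_def)
  then show "v \<in> extension_word w ` linear_extensions {1..length w} (word_arrow S R w)"
  proof induction
    case base
    show ?case
      using restrict_id_in_linear_extensions_word_arrow extension_word_restrict_id
      by (metis imageI)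
  next
    case (step u v)
    then show ?case
      using commutation_step_lifts_to_linear_extension by blast
  qed
qed

theorem theorem1p1:
  fixes S :: "'a set" and R :: "('a list \<times> 'a list) set" and w :: "'a list"
  assumes "R \<subseteq> lists S \<times> lists S"
    and "w \<in> lists S"
  shows "bij_betw (extension_word w)
    (linear_extensions {1..length w} (word_order S R w))
    (commutation_class S R w)"
  unfolding linear_extensions_word_order
proof (rule bij_betw_imageI)
  let ?L = "linear_extensions {1..length w} (word_arrow S R w)"
  show "inj_on (extension_word w) ?L"
    by (rule inj_on_extension_word)
  show "extension_word w ` ?L = commutation_class S R w"
  proof
    show "extension_word w ` ?L \<subseteq> commutation_class S R w"
      using extension_word_in_commutation_class[OF assms(2)] by blast
    show "commutation_class S R w \<subseteq> extension_word w ` ?L"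
      by (rule commutation_class_subset_extension_words)
  qed
qed

end
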